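(* Let $\mathcal{F}=\{f_i\}_{i=1}^K$ be a frame for $\mathbb{Z}_2^d$ and let $S=\Theta_{\mathcal{F}}\Theta_{\mathcal{F}}^*$. Let $\alpha$ be the vector in $\mathbb{Z}_2^K$ defined by $\alpha[i]=(f_i,f_i)$ for each $1\le i\le K$. Then $\|\alpha\|_0\equiv \operatorname{Tr}(S)\pmod 2$.
   Context: All vectors and matrices have entries in the two-element field $\mathbb{Z}_2$ and all operations are modulo 2. The dot product on $\mathbb{Z}_2^d$ is $(a,b)=\sum_{n=1}^d a[n]b[n]$. A (binary) frame for $\mathbb{Z}_2^d$ is a finite sequence of vectors $\{f_j\}_{j=1}^K$ (repetitions and zero vectors allowed) whose span is $\mathbb{Z}_2^d$. Its synthesis operator $\Theta_{\mathcal{F}}$ is the $d\times K$ matrix whose $j$th column is $f_j$; $^*$ denotes transpose. $\|\alpha\|_0$ is the number of nonzero entries of $\alpha$, and $\operatorname{Tr}$ is the trace. *)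

theory Defs
  imports "Jordan_Normal_Form.VS_Connect" "HOL-Library.Z2"
begin

(* A finite sequence f_1, ..., f_K in Z_2^d is a list of length K (so repetitions and zero
   vectors are allowed), and f_(i+1) is fs ! i. *)
definition binary_frame :: "nat \<Rightarrow> bit vec list \<Rightarrow> bool" where
  "binary_frame d fs \<longleftrightarrow>
     set fs \<subseteq> carrier_vec d \<and>
     LinearCombinations.module.span class_ring (module_vec TYPE(bit) d) (set fs) = carrier_vec d"

definition synthesis_operator :: "nat \<Rightarrow> bit vec list \<Rightarrow> bit mat" where
  "synthesis_operator d fs = mat_of_cols d fs"

definition mat_trace :: "'a :: comm_monoid_add mat \<Rightarrow> 'a" where
  "mat_trace A = (\<Sum>i<dim_row A. A $$ (i, i))"

definition l0_norm :: "'a :: zero vec \<Rightarrow> nat" where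
  "l0_norm v = card {i. i < dim_vec v \<and> v $ i \<noteq> 0}"

end

theory Submission
  imports Defs
begin

text \<open>
  Both sides equal the sum in \<open>\<int>\<^sub>2\<close> of the self-products \<open>(f\<^sub>i, f\<^sub>i)\<close>. For the left-hand side,
  every nonzero entry of a vector over \<open>\<int>\<^sub>2\<close> is \<open>1\<close>, so that counting nonzero entries modulo 2
  is adding up all entries (\<open>of_nat_l0_norm_bit\<close>). For the right-hand side, both
  \<open>Tr (A A\<^sup>T)\<close> and the sum of the self-products of the columns of \<open>A\<close> are the sum of the squares
  of all entries of \<open>A\<close>, taken row by row and column by column
  (\<open>mat_trace_times_transpose\<close>). That the vectors have length \<open>d\<close> makes them the columns of the
  synthesis operator.
\<close>

lemma of_nat_l0_norm_bit:
  fixes v :: "bit vec"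
  shows "of_nat (l0_norm v) = (\<Sum>i<dim_vec v. v $ i)"
proof -
  have "(\<Sum>i<dim_vec v. v $ i) = (\<Sum>i \<in> {i. i < dim_vec v \<and> v $ i \<noteq> 0}. v $ i)"
    by (rule sum.mono_neutral_right) auto
  also have "\<dots> = (\<Sum>i \<in> {i. i < dim_vec v \<and> v $ i \<noteq> 0}. 1)"
    by (rule sum.cong) auto
  finally show ?thesis
    by (simp add: l0_norm_def)
qed

lemma mat_trace_times_transpose:
  fixes A :: "'a :: comm_semiring_0 mat"
  shows "mat_trace (A * transpose_mat A) = (\<Sum>k<dim_col A. col A k \<bullet> col A k)"
proof -
  have "mat_trace (A * transpose_mat A)
      = (\<Sum>i<dim_row A. \<Sum>k<dim_col A. A $$ (i, k) * A $$ (i, k))"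
    by (simp add: mat_trace_def scalar_prod_def lessThan_atLeast0)
  also have "\<dots> = (\<Sum>k<dim_col A. \<Sum>i<dim_row A. A $$ (i, k) * A $$ (i, k))"
    by (rule sum.swap)
  also have "\<dots> = (\<Sum>k<dim_col A. col A k \<bullet> col A k)"
    by (simp add: scalar_prod_def lessThan_atLeast0)
  finally show ?thesis .
qed

(* Tr(S) is an element of Z_2; the congruence modulo 2 is equality with the residue class
   (of_nat) of the natural number l0_norm \<alpha>. *)
theorem theorem4p14:
  fixes d :: nat and fs :: "bit vec list" and S :: "bit mat" and \<alpha> :: "bit vec"
  assumes frame: "binary_frame d fs"
    and S: "S = synthesis_operator d fs * transpose_mat (synthesis_operator d fs)"
    and \<alpha>: "\<alpha> = vec (length fs) (\<lambda>i. (fs ! i) \<bullet> (fs ! i))"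
  shows "(of_nat (l0_norm \<alpha>) :: bit) = mat_trace S"
proof -
  have columns: "col (synthesis_operator d fs) i = fs ! i" if "i < length fs" for i
  proof -
    have "fs ! i \<in> carrier_vec d"
      using frame that nth_mem unfolding binary_frame_def by blast
    then show ?thesis
      using that unfolding synthesis_operator_def by simp
  qed
  have "of_nat (l0_norm \<alpha>) = (\<Sum>i<length fs. (fs ! i) \<bullet> (fs ! i))"
    by (simp add: of_nat_l0_norm_bit \<alpha>)
  also have "\<dots> = (\<Sum>i<length fs.
      col (synthesis_operator d fs) i \<bullet> col (synthesis_operator d fs) i)"
    by (simp add: columns)
  also have "\<dots> = mat_trace S"
    unfolding S mat_trace_times_transpose by (simp add: synthesis_operator_def)
  finally show ?thesis .
qed

end
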